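(* Let $V=\{1,\dots,N\}$ be a pool of examples, let $k$ be a budget, let $u_t(i)\ge 0$ (the discrimination utility of $i$) and $s_t(i,j)\ge 0$ (pairwise similarity) for $i,j\in V$, let $\lambda_t\ge 0$, and let $$G_t(S)=\sum_{i\in S}u_t(i)+\lambda_t\sum_{j\in V}\max_{i\in S}s_t(i,j),\qquad S\subseteq V.$$ Let $\tau_t\ge 0$ be a threshold, $B_t$ a swap budget, and $S_{t-1}\subseteq V$ with $|S_{t-1}|=k$. Let $S_t$ be the subset produced by the warm-start swap procedure at round $t$ (described in the context), started from $S_{t-1}$. Then, for $m_t$ accepted swaps at round $t$, the warm-start procedure ensures: (i) (bounded drift) $|S_t\,\triangle\,S_{t-1}|\le 2B_t$, where $\triangle$ denotes symmetric difference; (ii) (monotone improvement) $G_t(S_t)\ge G_t(S_{t-1})+m_t\tau_t$; (iii) (local optimality) if no swap exceeds the threshold $\tau_t$, then $S_t$ is a $\tau_t$-local optimum.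
   Context: Warm-start swap procedure: starting from $S=S_{t-1}$, perform at most $B_t$ one-for-one swaps. Each swap replaces the current set $S$ by $S'=(S\setminus\{i\})\cup\{j\}$ with $i\in S$, $j\notin S$, where the pair $(i,j)$ is chosen as $\arg\max_{i\in S,\,j\notin S}\; G_t\big((S\setminus\{i\})\cup\{j\}\big)-G_t(S)$, the choice being restricted to a candidate pool consisting of the top-$C$ elements by discrimination utility $u_t$ ($C$ is a fixed pool size). The swap is accepted only if $G_t(S')-G_t(S)>\tau_t$; if the selected swap does not satisfy this, the procedure stops. The final set is $S_t$. A swap "exceeds the threshold" if its gain $G_t(S')-G_t(S)$ is greater than $\tau_t$. A set $S\subseteq V$ with $|S|=k$ is a $\tau$-local optimum (with respect to the 1-swap neighborhood) if $G_t\big((S\setminus\{i\})\cup\{j\}\big)-G_t(S)\le\tau$ for all $i\in S$ and $j\in V\setminus S$. *)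

theory Defs
  imports Complex_Main
begin

text \<open>The maximum over the empty set is taken to be 0, the least possible value of a similarity;
  this only matters for the empty subset.\<close>

definition objective ::
  "'a set \<Rightarrow> ('a \<Rightarrow> real) \<Rightarrow> ('a \<Rightarrow> 'a \<Rightarrow> real) \<Rightarrow> real \<Rightarrow> 'a set \<Rightarrow> real" where
  "objective V u s lam S =
     (\<Sum>i\<in>S. u i) + lam * (\<Sum>j\<in>V. if S = {} then 0 else Max ((\<lambda>i. s i j) ` S))"

definition swap :: "'a set \<Rightarrow> 'a \<Rightarrow> 'a \<Rightarrow> 'a set" where
  "swap S i j = (S - {i}) \<union> {j}"

definition swap_gain :: "('a set \<Rightarrow> real) \<Rightarrow> 'a set \<Rightarrow> 'a \<Rightarrow> 'a \<Rightarrow> real" where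
  "swap_gain G S i j = G (swap S i j) - G S"

definition exceeds_threshold :: "('a set \<Rightarrow> real) \<Rightarrow> real \<Rightarrow> 'a set \<Rightarrow> 'a \<Rightarrow> 'a \<Rightarrow> bool" where
  "exceeds_threshold G \<tau> S i j \<longleftrightarrow> swap_gain G S i j > \<tau>"

text \<open>Ties in the utility make the top-\<open>C\<close> elements non-unique, so this is a predicate:
  any tie-breaking is allowed. If \<open>C\<close> is at least the size of \<open>V\<close>, the pool is \<open>V\<close>.\<close>

definition top_pool :: "'a set \<Rightarrow> ('a \<Rightarrow> real) \<Rightarrow> nat \<Rightarrow> 'a set \<Rightarrow> bool" where
  "top_pool V u C P \<longleftrightarrow>
     P \<subseteq> V \<and> card P = min C (card V) \<and> (\<forall>p\<in>P. \<forall>q\<in>V - P. u q \<le> u p)"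

text \<open>The pair \<open>(i, j)\<close> maximises the gain among the candidate swaps; any maximiser may be chosen.
  Inserted elements are taken from the pool \<open>P\<close>, removed ones from \<open>R\<close>, where \<open>R = V\<close> means that
  the pool restricts insertions only and \<open>R = P\<close> that it restricts both ends of the swap.\<close>

definition selected_swap ::
  "('a set \<Rightarrow> real) \<Rightarrow> 'a set \<Rightarrow> 'a set \<Rightarrow> 'a set \<Rightarrow> 'a \<Rightarrow> 'a \<Rightarrow> bool" where
  "selected_swap G R P S i j \<longleftrightarrow>
     is_arg_max (\<lambda>(i, j). swap_gain G S i j) (\<lambda>(i, j). i \<in> S \<inter> R \<and> j \<in> P - S) (i, j)"

text \<open>\<open>X 0, \<dots>, X m\<close> are the successive sets of a complete run with \<open>m\<close> accepted swaps: it ends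
  when the budget \<open>B\<close> is used up, when the selected swap is rejected, or when there is no
  candidate swap left. Values of \<open>X\<close> beyond \<open>m\<close> are irrelevant.\<close>

definition warm_start_run ::
  "('a set \<Rightarrow> real) \<Rightarrow> 'a set \<Rightarrow> 'a set \<Rightarrow> real \<Rightarrow> nat \<Rightarrow> 'a set \<Rightarrow> nat \<Rightarrow> (nat \<Rightarrow> 'a set) \<Rightarrow> bool" where
  "warm_start_run G R P \<tau> B S0 m X \<longleftrightarrow>
     X 0 = S0 \<and> m \<le> B \<and>
     (\<forall>l<m. \<exists>i j. selected_swap G R P (X l) i j \<and> exceeds_threshold G \<tau> (X l) i j \<and>
                  X (Suc l) = swap (X l) i j) \<and>
     (m < B \<longrightarrow> (\<forall>i j. selected_swap G R P (X m) i j \<longrightarrow> \<not> exceeds_threshold G \<tau> (X m) i j))"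

definition local_optimum ::
  "'a set \<Rightarrow> nat \<Rightarrow> ('a set \<Rightarrow> real) \<Rightarrow> real \<Rightarrow> 'a set \<Rightarrow> bool" where
  "local_optimum V k G \<tau> S \<longleftrightarrow>
     S \<subseteq> V \<and> card S = k \<and> (\<forall>i\<in>S. \<forall>j\<in>V - S. swap_gain G S i j \<le> \<tau>)"

end

theory Submission
  imports Defs
begin

text \<open>Everything rests on the effect of one accepted swap: the size of the set is kept, its
  symmetric difference with the starting set grows by at most two, and \<open>G\<close> rises by
  more than \<open>\<tau>\<close>. Induction over the accepted swaps
  (\<open>warm_start_run_invariant\<close>) sums these effects, and \<open>m \<le> B\<close> turns
  the drift \<open>2 * m\<close> into \<open>2 * B\<close>. Local optimality comes from the stopping
  behaviour: a visited set with no swap above the threshold anywhere in \<open>V\<close> admits no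
  accepted swap, so the run ends there and that set is \<open>S_t\<close>.\<close>

lemma card_swap:
  assumes "finite S" "i \<in> S" "j \<notin> S"
  shows "card (swap S i j) = card S"
  \<comment> \<open>Removal and insertion give \<open>Suc (card S - 1)\<close>; positivity of
    \<open>card S\<close> makes the truncated subtraction harmless.\<close>
  using assms card_gt_0_iff[of S] by (auto simp: swap_def)

text \<open>Only \<open>i\<close> and \<open>j\<close> can change membership, so the new symmetric
  difference lies in the old one together with \<open>{i, j}\<close>.\<close>

lemma card_sym_diff_swap_le:
  assumes "finite S" "finite T"
  shows "card (sym_diff (swap S i j) T) \<le> card (sym_diff S T) + 2"
proof -
  have "card (sym_diff (swap S i j) T) \<le> card (sym_diff S T \<union> {i, j})"
    using assms by (intro card_mono) (auto simp: swap_def)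
  also have "\<dots> \<le> card (sym_diff S T) + card {i, j}"
    by (rule card_Un_le)
  also have "\<dots> \<le> card (sym_diff S T) + 2"
    by (simp add: card_insert_if)
  finally show ?thesis .
qed

lemma warm_start_run_step:
  assumes "warm_start_run G R P \<tau> B S0 m X" "l < m"
  obtains i j where "i \<in> X l" "j \<in> P - X l" "exceeds_threshold G \<tau> (X l) i j"
    "X (Suc l) = swap (X l) i j"
proof -
  from assms obtain i j where "selected_swap G R P (X l) i j"
    "exceeds_threshold G \<tau> (X l) i j" "X (Suc l) = swap (X l) i j"
    unfolding warm_start_run_def by blast
  then show thesis
    by (intro that[of i j]) (simp_all add: selected_swap_def is_arg_max_def)
qed

text \<open>The claims are carried through one induction because \<open>X l \<subseteq> V\<close>
  supplies the finiteness that both cardinality steps require.\<close>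

lemma warm_start_run_invariant:
  assumes run: "warm_start_run G R P \<tau> B S0 m X"
    and V: "finite V" "P \<subseteq> V" "S0 \<subseteq> V"
    and "l \<le> m"
  shows "X l \<subseteq> V \<and> card (X l) = card S0 \<and> card (sym_diff (X l) S0) \<le> 2 * l
    \<and> G (X l) \<ge> G S0 + real l * \<tau>"
  using \<open>l \<le> m\<close>
proof (induction l)
  case 0
  then show ?case using run V by (simp add: warm_start_run_def)
next
  case (Suc l)
  then have IH: "X l \<subseteq> V" "card (X l) = card S0" "card (sym_diff (X l) S0) \<le> 2 * l"
    "G (X l) \<ge> G S0 + real l * \<tau>" and "l < m"
    by auto
  from run \<open>l < m\<close> obtain i j where ij: "i \<in> X l" "j \<in> P - X l"
    "exceeds_threshold G \<tau> (X l) i j" and X: "X (Suc l) = swap (X l) i j"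
    by (rule warm_start_run_step)
  have fin: "finite (X l)" "finite S0"
    using IH(1) V finite_subset by blast+
  have "X (Suc l) \<subseteq> V"
    using X IH(1) ij(2) V(2) by (auto simp: swap_def)
  moreover have "card (X (Suc l)) = card S0"
    using X IH(2) ij card_swap[OF fin(1)] by simp
  moreover have "card (sym_diff (X (Suc l)) S0) \<le> 2 * Suc l"
    using X IH(3) card_sym_diff_swap_le[OF fin, of i j] by simp
  moreover have "G (X (Suc l)) \<ge> G S0 + real (Suc l) * \<tau>"
    using X IH(4) ij(3) by (simp add: exceeds_threshold_def swap_gain_def algebra_simps)
  ultimately show ?case by blast
qed

theorem proposition3:
  fixes N k C B m :: nat
    and V P R S_prev S_t :: "nat set"
    and u :: "nat \<Rightarrow> real" and s :: "nat \<Rightarrow> nat \<Rightarrow> real"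
    and lam \<tau> :: real
    and G :: "nat set \<Rightarrow> real"
    and X :: "nat \<Rightarrow> nat set"
  assumes V: "V = {1..N}"
    and u_nonneg: "\<And>i. i \<in> V \<Longrightarrow> u i \<ge> 0"
    and s_nonneg: "\<And>i j. i \<in> V \<Longrightarrow> j \<in> V \<Longrightarrow> s i j \<ge> 0"
    and lam_nonneg: "lam \<ge> 0"
    and tau_nonneg: "\<tau> \<ge> 0"
    and G: "G = objective V u s lam"
    and S_prev: "S_prev \<subseteq> V" "card S_prev = k"
    and pool: "top_pool V u C P"
    and removable: "R = V \<or> R = P"
    and run: "warm_start_run G R P \<tau> B S_prev m X"
    and S_t: "S_t = X m"
  shows "card (sym_diff S_t S_prev) \<le> 2 * B
    \<and> G S_t \<ge> G S_prev + real m * \<tau>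
    \<and> ((\<exists>l\<le>m. \<forall>i\<in>X l. \<forall>j\<in>V - X l. \<not> exceeds_threshold G \<tau> (X l) i j)
         \<longrightarrow> local_optimum V k G \<tau> S_t)"
proof -
  have fin: "finite V" and PV: "P \<subseteq> V"
    using V pool by (auto simp: top_pool_def)
  have "m \<le> B"
    using run by (simp add: warm_start_run_def)
  have inv: "X m \<subseteq> V" "card (X m) = k" "card (sym_diff (X m) S_prev) \<le> 2 * m"
    "G (X m) \<ge> G S_prev + real m * \<tau>"
    using warm_start_run_invariant[OF run fin PV S_prev(1) order_refl] S_prev(2) by auto
  have "local_optimum V k G \<tau> S_t"
    if "l \<le> m" and l: "\<forall>i\<in>X l. \<forall>j\<in>V - X l. \<not> exceeds_threshold G \<tau> (X l) i j" for l
  proof -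
    \<comment> \<open>Swaps accepted before step \<open>m\<close> exceed the threshold, so \<open>X l\<close> must be the final set.\<close>
    have "\<not> l < m"
    proof
      assume "l < m"
      with run obtain i j where "i \<in> X l" "j \<in> P - X l" "exceeds_threshold G \<tau> (X l) i j"
        by (rule warm_start_run_step)
      \<comment> \<open>The accepted \<open>j\<close> comes from the pool;
        \<open>P \<subseteq> V\<close> places it in the range of the assumption on
        \<open>X l\<close>, which concerns all of \<open>V\<close>.\<close>
      then show False
        using l PV by blast
    qed
    with \<open>l \<le> m\<close> have "l = m" by simp
    then show ?thesis
      using l inv S_t by (auto simp: local_optimum_def exceeds_threshold_def not_less)
  qed
  then show ?thesis
    using inv \<open>m \<le> B\<close> S_t by auto
qed

end
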